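(* Let the ILRFPP model on $\mathbb{Z}^d$ satisfy the standing assumptions, suppose $$\frac{2d}{\gamma}<\alpha<\frac{2d}{\gamma}+1,$$ and set $\Delta:=\alpha-2d/\gamma\in(0,1)$. Fix $x\in\mathbb{R}^d$ with $\|x\|_\infty\le1$, $x\neq0$, and let $T_n:=T(0,\lceil nx\rceil)$. Then for every $\varepsilon>0$ there exists $C<\infty$ such that $$\mathbb{P}\big(T_n>C\,n^{\Delta+\varepsilon}\big)\xrightarrow[n\to\infty]{}0.$$ In particular $T_n=O_{\mathbb{P}}(n^{\alpha-2d/\gamma+\varepsilon})$ for every $\varepsilon>0$.
   Context: Model (inhomogeneous long-range first-passage percolation, ILRFPP). Fix an integer $d\ge1$ and $\alpha>0$; $\|\cdot\|$ is the $\ell_1$ norm on $\mathbb{Z}^d$. The vertex weights $(V_x)_{x\in\mathbb{Z}^d}$ are i.i.d. with the law of a random variable $V$; the edge noises $\omega_{xy}=\omega_{yx}\ge0$, one for every unordered pair $\{x,y\}$ of distinct vertices of $\mathbb{Z}^d$ (all pairs are edges), are i.i.d. with the law of $\omega$, and independent of the vertex weights. The passage time of an edge is $W_{xy}:=\|x-y\|^{\alpha}\,\omega_{xy}/(V_xV_y)$. A path is a finite sequence of distinct vertices; its passage time is the sum of $W$ over its consecutive edges. $T(x,y)$ is the infimum of the passage times over all finite self-avoiding paths from $x$ to $y$. $\lceil nx\rceil$ is the coordinatewise ceiling. Standing assumptions: for fixed $\gamma,\theta,\zeta>0$, $\mathbb{P}(0<V<\infty)=1$ and $\lim_{x\to\infty}\log\mathbb{P}(V\ge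 x)/\log x=-\gamma$; $\lim_{x\downarrow0}\log\mathbb{P}(\omega\le x)/\log x=\theta$ and $\mathbb{E}\,\omega^{\zeta}<\infty$. *)

theory Defs
  imports "HOL-Probability.Probability"
begin

type_synonym 'd vertex = "int ^ 'd"

definition l1_norm :: "'d::finite vertex \<Rightarrow> real" where
  "l1_norm x = (\<Sum>i\<in>UNIV. real_of_int \<bar>x $ i\<bar>)"

definition edges :: "'d::finite vertex set set" where
  "edges = {{x, y} | x y. x \<noteq> y}"

definition ceiling_vec :: "real ^ 'd \<Rightarrow> 'd::finite vertex" where
  "ceiling_vec x = (\<chi> i. \<lceil>x $ i\<rceil>)"

text \<open>
  The noises are indexed by the unordered pair, so that they are symmetric by construction.
  Indexing vertices and edges by one sum type lets a single \<open>indep_vars\<close> express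
  that the weights are independent, that the noises are independent, and that the two
  families are independent of each other. The laws of the generic variables \<open>V\<close> and
  \<open>\<omega>\<close> of the model are the measures \<open>\<mu>\<close> and \<open>\<nu>\<close> on the real line.
\<close>

locale ilrfpp = prob_space M for M :: "'w measure" +
  fixes \<mu> \<nu> :: "real measure"
    and \<alpha> :: real
    and V :: "'d::finite vertex \<Rightarrow> 'w \<Rightarrow> real"
    and \<omega> :: "'d vertex set \<Rightarrow> 'w \<Rightarrow> real"
  assumes alpha_pos: "\<alpha> > 0"
    and indep: "indep_vars (\<lambda>_. borel) (case_sum V \<omega>) (UNIV <+> edges)"
    and law_V: "\<And>x. distr M borel (V x) = \<mu>"
    and law_omega: "\<And>e. e \<in> edges \<Longrightarrow> distr M borel (\<omega> e) = \<nu>"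
    and omega_nonneg: "AE t in \<nu>. t \<ge> 0"

text \<open>
  Since \<open>ln 0\<close> is an ordinary real constant, and the probabilities below are monotone in
  \<open>t\<close>, the two limits being nonzero forces these probabilities to be positive, as it does
  under the convention \<open>log 0 = - \<infinity>\<close>.
\<close>

definition standing_assumptions ::
  "real measure \<Rightarrow> real measure \<Rightarrow> real \<Rightarrow> real \<Rightarrow> real \<Rightarrow> bool" where
  "standing_assumptions \<mu> \<nu> \<gamma> \<theta> \<zeta> \<longleftrightarrow>
     \<gamma> > 0 \<and> \<theta> > 0 \<and> \<zeta> > 0 \<and>
     (AE t in \<mu>. t > 0) \<and>
     ((\<lambda>t. ln (measure \<mu> {t..}) / ln t) \<longlongrightarrow> - \<gamma>) at_top \<and>
     ((\<lambda>t. ln (measure \<nu> {..t}) / ln t) \<longlongrightarrow> \<theta>) (at_right 0) \<and>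
     integrable \<nu> (\<lambda>t. t powr \<zeta>)"

text \<open>
  Passage times take values in \<open>ennreal\<close>, so that every infimum is the true one. Almost
  surely the weights are positive and the noises nonnegative; the truncation of negative
  reals and the division by zero only matter on a null set.
\<close>

definition edge_time ::
  "real \<Rightarrow> ('d::finite vertex \<Rightarrow> 'w \<Rightarrow> real) \<Rightarrow> ('d vertex set \<Rightarrow> 'w \<Rightarrow> real) \<Rightarrow>
   'd vertex \<Rightarrow> 'd vertex \<Rightarrow> 'w \<Rightarrow> ennreal" where
  "edge_time \<alpha> V \<omega> x y w =
     ennreal (l1_norm (x - y) powr \<alpha> * \<omega> {x, y} w / (V x w * V y w))"

definition paths :: "'d::finite vertex \<Rightarrow> 'd vertex \<Rightarrow> 'd vertex list set" where
  "paths x y = {p. p \<noteq> [] \<and> distinct p \<and> hd p = x \<and> last p = y}"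

definition path_time ::
  "real \<Rightarrow> ('d::finite vertex \<Rightarrow> 'w \<Rightarrow> real) \<Rightarrow> ('d vertex set \<Rightarrow> 'w \<Rightarrow> real) \<Rightarrow>
   'd vertex list \<Rightarrow> 'w \<Rightarrow> ennreal" where
  "path_time \<alpha> V \<omega> p w = (\<Sum>i<length p - 1. edge_time \<alpha> V \<omega> (p ! i) (p ! Suc i) w)"

definition passage_time ::
  "real \<Rightarrow> ('d::finite vertex \<Rightarrow> 'w \<Rightarrow> real) \<Rightarrow> ('d vertex set \<Rightarrow> 'w \<Rightarrow> real) \<Rightarrow>
   'd vertex \<Rightarrow> 'd vertex \<Rightarrow> 'w \<Rightarrow> ennreal" where
  "passage_time \<alpha> V \<omega> x y w = (INF p\<in>paths x y. path_time \<alpha> V \<omega> p w)"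

definition bigo_in_prob ::
  "'w measure \<Rightarrow> (nat \<Rightarrow> 'w \<Rightarrow> ennreal) \<Rightarrow> (nat \<Rightarrow> real) \<Rightarrow> bool" where
  "bigo_in_prob M X a \<longleftrightarrow>
     (\<forall>\<eta>>0. \<exists>K::real. \<forall>\<^sub>F n in sequentially. \<P>(w in M. X n w > ennreal (K * a n)) \<le> \<eta>)"

end

theory Submission
  imports Defs "HOL-Real_Asymp.Real_Asymp"
begin

text \<open>
  Write \<open>d\<close> for the dimension and \<open>\<beta> = d / \<gamma>\<close>. A cube of radius \<open>R\<close> contains about \<open>R\<^sup>d\<close>
  vertices, and a weight exceeds \<open>t\<close> with probability about \<open>t\<close> to the power \<open>- \<gamma>\<close>, so some
  vertex of the cube, its hub, has a weight of about \<open>R\<close> to the power \<open>\<beta>\<close>. The edge between two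
  hubs of cubes of radius \<open>n\<close> at distance \<open>n\<close> therefore has a passage time of about
  \<open>n\<close> to the power \<open>\<alpha> - 2 * \<beta> = \<Delta>\<close>. An edge from the origin straight to such a hub would be
  far too slow, because only one of its two endpoints is heavy. Instead the path climbs to the
  hub through the hubs of the cubes of radius \<open>n powr (j / J)\<close> for \<open>j = 0, \<dots>, J\<close>, all
  centred at the origin, where the cube of scale \<open>0\<close> is the origin alone. It then jumps to the
  hub of scale \<open>J\<close> around the target and descends symmetrically. The step from scale
  \<open>j\<close> to \<open>j + 1\<close> has an exponent of about
  \<open>((j + 1) * \<alpha> - (2 * j + 1) * \<beta>) / J = ((j + 1) * \<Delta> + \<beta>) / J\<close>,
  which is at most \<open>\<Delta> + \<beta> / J\<close> since \<open>\<Delta> > 0\<close>.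

  The number \<open>J\<close> of scales depends on \<open>\<epsilon>\<close> but not on \<open>n\<close>. So the path has a bounded number of
  edges, and it suffices that each single requirement holds with probability tending to one,
  with a spare factor \<open>n powr \<kappa>\<close>: there is a vertex of weight at least
  \<open>n powr (j * \<beta> / J - \<kappa>)\<close> at each scale (\<open>no_hub_in_cube_tendsto_0\<close> for \<open>j > 0\<close>,
  \<open>small_weight_tendsto_0\<close> for the endpoints), and the noise on each edge used is at most
  \<open>n powr \<kappa>\<close> (\<open>large_noise_tendsto_0\<close>).

  The edges are random, since the hubs are. But the hubs are functions of the weights, which
  are independent of the noises, so the noise on an edge between two hubs is as likely to be
  large as on a fixed edge (\<open>prob_noise_between_hubs\<close>). The union bound over the chain is
  \<open>prob_passage_time_chain\<close>. Hubs of different scales may coincide; removing the loops of the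
  walk through them does not increase its passage time (\<open>passage_time_le_walk\<close>).
\<close>

section \<open>Walks and passage times\<close>

lemma path_time_singleton: "path_time \<alpha> V \<omega> [a] w = 0"
  by (simp add: path_time_def)

lemma path_time_Cons:
  "path_time \<alpha> V \<omega> (a # b # p) w = edge_time \<alpha> V \<omega> a b w + path_time \<alpha> V \<omega> (b # p) w"
  by (simp add: path_time_def sum.lessThan_Suc_shift del: sum.lessThan_Suc)

lemma path_time_append:
  "path_time \<alpha> V \<omega> (p @ a # q) w = path_time \<alpha> V \<omega> (p @ [a]) w + path_time \<alpha> V \<omega> (a # q) w"
proof (induction p)
  case Nil
  then show ?case by (simp add: path_time_singleton)
next
  case (Cons b p)
  then show ?case by (cases p) (auto simp: path_time_Cons path_time_singleton add.assoc)
qed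

text \<open>
  Edge times are nonnegative, so cutting out the piece between two visits to the same vertex
  does not increase the passage time, and shortens the walk. Hence the infimum over
  self-avoiding paths is also a lower bound for all walks.
\<close>

lemma passage_time_le_walk:
  assumes "p \<noteq> []"
  shows "passage_time \<alpha> V \<omega> (hd p) (last p) w \<le> path_time \<alpha> V \<omega> p w"
  using assms
proof (induction p rule: length_induct)
  case (1 p)
  show ?case
  proof (cases "distinct p")
    case True
    with 1(2) have "p \<in> paths (hd p) (last p)"
      by (simp add: paths_def)
    then show ?thesis
      unfolding passage_time_def by (rule INF_lower)
  next
    case False
    then obtain xs ys zs a where p: "p = xs @ [a] @ ys @ [a] @ zs"
      using not_distinct_decomp by blast
    let ?q = "xs @ a # zs"
    have "hd ?q = hd p" "last ?q = last p"
      by (auto simp: p hd_append)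
    moreover have "passage_time \<alpha> V \<omega> (hd ?q) (last ?q) w \<le> path_time \<alpha> V \<omega> ?q w"
      by (rule 1(1)[rule_format]) (simp_all add: p)
    moreover have "path_time \<alpha> V \<omega> ?q w \<le> path_time \<alpha> V \<omega> p w"
    proof -
      have "path_time \<alpha> V \<omega> p w = path_time \<alpha> V \<omega> (xs @ [a]) w
          + (path_time \<alpha> V \<omega> (a # ys @ [a]) w + path_time \<alpha> V \<omega> (a # zs) w)"
        using path_time_append[of \<alpha> V \<omega> xs a "ys @ a # zs" w]
          path_time_append[of \<alpha> V \<omega> "a # ys" a zs w] by (simp add: p)
      moreover have "path_time \<alpha> V \<omega> ?q w = path_time \<alpha> V \<omega> (xs @ [a]) w + path_time \<alpha> V \<omega> (a # zs) w"
        by (rule path_time_append)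
      ultimately show ?thesis
        by (auto intro!: add_left_mono simp: add_increasing)
    qed
    ultimately show ?thesis by simp
  qed
qed

lemma passage_time_le_sum_edge_times:
  "passage_time \<alpha> V \<omega> (h 0) (h m) w \<le> (\<Sum>i<m. edge_time \<alpha> V \<omega> (h i) (h (Suc i)) w)"
proof -
  have *: "map h [0..<Suc m] \<noteq> []" by simp
  have "hd (map h [0..<Suc m]) = h 0"
    by (simp add: hd_conv_nth del: upt_Suc)
  moreover have "last (map h [0..<Suc m]) = h m"
    by simp
  moreover have "path_time \<alpha> V \<omega> (map h [0..<Suc m]) w
      = (\<Sum>i<m. edge_time \<alpha> V \<omega> (h i) (h (Suc i)) w)"
    unfolding path_time_def by (rule sum.cong) (auto simp del: upt_Suc)
  ultimately show ?thesis
    using passage_time_le_walk[OF *, of \<alpha> V \<omega> w] by simp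
qed

section \<open>Hubs\<close>

text \<open>
  The vertex is chosen as a function of the set of vertices of \<open>A\<close> whose weight reaches \<open>s\<close>,
  not as one of maximal weight: for finite \<open>A\<close> this set takes finitely many values, so any
  choice from it is measurable. If no weight reaches \<open>s\<close>, the hub is still a vertex of a
  nonempty \<open>A\<close>, which keeps the number of possible hubs finite.
\<close>

definition hub :: "'a set \<Rightarrow> real \<Rightarrow> ('a \<Rightarrow> real) \<Rightarrow> 'a" where
  "hub A s v = (SOME a. a \<in> A \<and> ({b\<in>A. s \<le> v b} \<noteq> {} \<longrightarrow> a \<in> {b\<in>A. s \<le> v b}))"

lemma hub_in:
  assumes "A \<noteq> {}"
  shows "hub A s v \<in> A"
  using someI_ex[of "\<lambda>a. a \<in> A \<and> ({b\<in>A. s \<le> v b} \<noteq> {} \<longrightarrow> a \<in> {b\<in>A. s \<le> v b})"] assms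
  unfolding hub_def by blast

lemma hub_ge:
  assumes "b \<in> A" "s \<le> v b"
  shows "s \<le> v (hub A s v)"
  using someI_ex[of "\<lambda>a. a \<in> A \<and> ({b\<in>A. s \<le> v b} \<noteq> {} \<longrightarrow> a \<in> {b\<in>A. s \<le> v b})"] assms
  unfolding hub_def by blast

lemma hub_restrict:
  assumes "A \<subseteq> B"
  shows "hub A s (restrict v B) = hub A s v"
proof -
  have "{b\<in>A. s \<le> restrict v B b} = {b\<in>A. s \<le> v b}"
    using assms by (auto simp: restrict_def)
  then show ?thesis by (simp only: hub_def)
qed

lemma measurable_hub:
  assumes "finite A" "A \<subseteq> B"
  shows "hub A s \<in> PiM B (\<lambda>_. borel) \<rightarrow>\<^sub>M count_space UNIV"
proof -
  let ?f = "\<lambda>v. {b\<in>A. s \<le> v b}"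
  have "?f \<in> PiM B (\<lambda>_. borel) \<rightarrow>\<^sub>M count_space (Pow A)"
  proof (subst measurable_count_space_eq2)
    show "?f \<in> space (Pi\<^sub>M B (\<lambda>_. borel)) \<rightarrow> Pow A \<and>
      (\<forall>S\<in>Pow A. ?f -` {S} \<inter> space (PiM B (\<lambda>_. borel)) \<in> sets (PiM B (\<lambda>_. borel)))"
    proof (intro conjI ballI)
      fix S assume "S \<in> Pow A"
      then have "?f -` {S} \<inter> space (PiM B (\<lambda>_. borel))
          = {v \<in> space (PiM B (\<lambda>_. borel)). \<forall>b\<in>A. (s \<le> v b) = (b \<in> S)}"
        by auto
      also have "\<dots> \<in> sets (PiM B (\<lambda>_. borel))"
      proof (rule sets.sets_Collect_finite_All[OF _ \<open>finite A\<close>])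
        fix b assume "b \<in> A"
        then have [measurable]: "(\<lambda>v. v b) \<in> PiM B (\<lambda>_. borel) \<rightarrow>\<^sub>M (borel :: real measure)"
          using assms by (intro measurable_component_singleton) auto
        show "{v \<in> space (PiM B (\<lambda>_. borel)). (s \<le> v b) = (b \<in> S)} \<in> sets (PiM B (\<lambda>_. borel))"
          by measurable
      qed
      finally show "?f -` {S} \<inter> space (PiM B (\<lambda>_. borel)) \<in> sets (PiM B (\<lambda>_. borel))" .
    qed auto
  qed (use assms in auto)
  then have "(\<lambda>S. SOME a. a \<in> A \<and> (S \<noteq> {} \<longrightarrow> a \<in> S)) \<circ> ?f \<in> PiM B (\<lambda>_. borel) \<rightarrow>\<^sub>M count_space UNIV"
    by (rule measurable_comp) simp
  then show ?thesis
    by (simp add: comp_def hub_def[abs_def])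
qed

section \<open>Probabilities along a chain of hubs\<close>

context ilrfpp
begin

lemma measurable_weight [measurable]: "V a \<in> borel_measurable M"
  using indep by (force simp: indep_vars_def)

lemma measurable_noise [measurable]: "e \<in> edges \<Longrightarrow> \<omega> e \<in> borel_measurable M"
  using indep by (force simp: indep_vars_def)

lemma prob_weights_small:
  assumes "finite A" "A \<noteq> {}"
  shows "prob {w \<in> space M. \<forall>a\<in>A. V a w < s} = (1 - measure \<mu> {s..}) ^ card A"
proof -
  have *: "prob (V a -` {..<s} \<inter> space M) = 1 - measure \<mu> {s..}" for a
  proof -
    interpret \<mu>: prob_space \<mu>
      unfolding law_V[of a, symmetric] by (rule prob_space_distr) measurable
    have [simp]: "sets \<mu> = sets borel" and sp: "space \<mu> = UNIV"
      by (simp_all add: law_V[of a, symmetric])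
    have "prob (V a -` {..<s} \<inter> space M) = measure \<mu> {..<s}"
      by (simp add: law_V[of a, symmetric] measure_distr)
    moreover have "{..<s} = space \<mu> - {s..}"
      by (auto simp: sp)
    moreover have "measure \<mu> (space \<mu> - {s..}) = 1 - measure \<mu> {s..}"
      by (rule \<mu>.prob_compl) simp
    ultimately show ?thesis by simp
  qed
  have "{w \<in> space M. \<forall>a\<in>A. V a w < s}
      = (\<Inter>i\<in>Inl ` A. case_sum V \<omega> i -` {..<s} \<inter> space M)"
    using assms by auto
  also have "prob \<dots> = (\<Prod>i\<in>Inl ` A. prob (case_sum V \<omega> i -` {..<s} \<inter> space M))"
    by (rule indep_varsD[OF indep]) (use assms in auto)
  also have "\<dots> = (\<Prod>a\<in>A. prob (V a -` {..<s} \<inter> space M))"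
    by (subst prod.reindex) auto
  finally show ?thesis
    by (simp add: *)
qed

text \<open>
  The joint independence of weights and noises, in the form in which the weights enter through
  an arbitrary event of their product space.
\<close>

lemma prob_weights_and_noise:
  assumes e: "e \<in> edges" and B: "B \<in> sets (PiM A (\<lambda>_. borel))"
  shows "prob {w \<in> space M. (\<lambda>a\<in>A. V a w) \<in> B \<and> u < \<omega> e w}
    = prob {w \<in> space M. (\<lambda>a\<in>A. V a w) \<in> B} * measure \<nu> {u<..}"
proof -
  let ?X = "\<lambda>w. \<lambda>i\<in>Inl ` A. case_sum V \<omega> i w" and ?Y = "\<lambda>w. \<lambda>i\<in>{Inr e}. case_sum V \<omega> i w"
  let ?P = "PiM (Inl ` A :: ('d vertex + 'd vertex set) set) (\<lambda>_. borel :: real measure)"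
    and ?Q = "PiM {Inr e :: 'd vertex + 'd vertex set} (\<lambda>_. borel :: real measure)"
  let ?f = "\<lambda>v. \<lambda>a\<in>A. v (Inl a)" and ?g = "\<lambda>v. v (Inr e)"
  have ind: "indep_var ?P ?X ?Q ?Y"
    by (rule indep_var_restrict[OF indep]) (use e in auto)
  define S where "S = ?f -` B \<inter> space ?P"
  define R where "R = ?g -` {u<..} \<inter> space ?Q"
  have "?f \<in> ?P \<rightarrow>\<^sub>M PiM A (\<lambda>_. borel)" "?g \<in> ?Q \<rightarrow>\<^sub>M borel"
    by (auto intro!: measurable_restrict measurable_component_singleton)
  then have sets: "S \<in> sets ?P" "R \<in> sets ?Q"
    unfolding S_def R_def using B by (auto intro: measurable_sets)
  have "(\<lambda>a\<in>A. ?X w (Inl a)) = (\<lambda>a\<in>A. V a w)" for w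
    by (rule restrict_ext) simp
  then have X: "?X w \<in> S \<longleftrightarrow> (\<lambda>a\<in>A. V a w) \<in> B" for w
    by (simp add: S_def space_PiM)
  have Y: "?Y w \<in> R \<longleftrightarrow> u < \<omega> e w" for w
    by (simp add: R_def space_PiM)
  have "prob ((\<lambda>w. (?X w, ?Y w)) -` (S \<times> R) \<inter> space M)
      = prob (?X -` S \<inter> space M) * prob (?Y -` R \<inter> space M)"
    by (rule indep_varD[OF ind sets])
  moreover have "(\<lambda>w. (?X w, ?Y w)) -` (S \<times> R) \<inter> space M
      = {w \<in> space M. (\<lambda>a\<in>A. V a w) \<in> B \<and> u < \<omega> e w}"
    by (rule set_eqI) (simp only: vimage_eq Int_iff mem_Times_iff fst_conv snd_conv X Y mem_Collect_eq conj_ac)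
  moreover have "?X -` S \<inter> space M = {w \<in> space M. (\<lambda>a\<in>A. V a w) \<in> B}"
    by (rule set_eqI) (simp only: vimage_eq Int_iff X mem_Collect_eq conj_ac)
  moreover have "?Y -` R \<inter> space M = \<omega> e -` {u<..} \<inter> space M"
    by (rule set_eqI) (simp only: vimage_eq Int_iff Y greaterThan_iff)
  moreover have "prob (\<omega> e -` {u<..} \<inter> space M) = measure \<nu> {u<..}"
    using e by (simp add: law_omega[of e, symmetric] measure_distr)
  ultimately show ?thesis
    by (simp only:)
qed

text \<open>
  Given the weights, the pair of hubs is a fixed edge, whose noise is still distributed
  according to \<open>\<nu>\<close>. Formally, the event is split according to the finitely many values of the
  pair of hubs, and the probabilities of these values sum to at most one. A pair of equal hubs
  is excluded because it is not an edge.
\<close>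

lemma prob_noise_between_hubs:
  fixes s t u :: real
  assumes fin: "finite A" "finite B" and ne: "A \<noteq> {}" "B \<noteq> {}"
  defines "h \<equiv> \<lambda>w. hub A s (\<lambda>a. V a w)"
    and "k \<equiv> \<lambda>w. hub B t (\<lambda>b. V b w)"
  shows "{w \<in> space M. h w \<noteq> k w \<and> u < \<omega> {h w, k w} w} \<in> events" (is "?E \<in> _")
    and "prob {w \<in> space M. h w \<noteq> k w \<and> u < \<omega> {h w, k w} w} \<le> measure \<nu> {u<..}"
proof -
  define I where "I = {(a, b) \<in> A \<times> B. a \<noteq> b}"
  define S where "S = (\<lambda>(a, b). {v \<in> space (PiM (A \<union> B) (\<lambda>_. borel)). hub A s v = a \<and> hub B t v = b})"
  define F where "F = (\<lambda>p. {w \<in> space M. (\<lambda>c\<in>A \<union> B. V c w) \<in> S p})"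
  define G where "G = (\<lambda>p. {w \<in> space M. (\<lambda>c\<in>A \<union> B. V c w) \<in> S p \<and> u < \<omega> {fst p, snd p} w})"
  have edge: "{fst p, snd p} \<in> edges" if "p \<in> I" for p
  proof -
    have "fst p \<noteq> snd p"
      using that by (auto simp: I_def)
    then show ?thesis
      unfolding edges_def by blast
  qed
  have [simp]: "finite I"
    unfolding I_def by (rule finite_subset[of _ "A \<times> B"]) (use fin in auto)
  have S: "S p \<in> sets (PiM (A \<union> B) (\<lambda>_. borel))" for p
  proof -
    have [measurable]: "hub A s \<in> PiM (A \<union> B) (\<lambda>_. borel) \<rightarrow>\<^sub>M count_space UNIV"
      "hub B t \<in> PiM (A \<union> B) (\<lambda>_. borel) \<rightarrow>\<^sub>M count_space UNIV"
      using fin by (auto intro: measurable_hub)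
    show ?thesis
      unfolding S_def by (cases p) simp
  qed
  have weights: "(\<lambda>w. \<lambda>c\<in>A \<union> B. V c w) \<in> M \<rightarrow>\<^sub>M PiM (A \<union> B) (\<lambda>_. borel)"
    by (intro measurable_restrict) measurable
  have F: "F p \<in> events" for p
    using measurable_sets[OF weights S[of p]] by (simp add: F_def vimage_def Int_def conj_ac)
  have G: "G p \<in> events" if "p \<in> I" for p
  proof -
    have "G p = F p \<inter> (\<omega> {fst p, snd p} -` {u<..} \<inter> space M)"
      by (auto simp: F_def G_def)
    then show ?thesis
      using F measurable_sets[OF measurable_noise[OF edge[OF that]], of "{u<..}"] by auto
  qed
  have "(\<lambda>c\<in>A \<union> B. V c w) \<in> space (PiM (A \<union> B) (\<lambda>_. borel))" for w
    by (simp add: space_PiM)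
  then have inS: "(\<lambda>c\<in>A \<union> B. V c w) \<in> S p \<longleftrightarrow> h w = fst p \<and> k w = snd p" for w p
    by (simp add: S_def h_def k_def hub_restrict split: prod.split)
  have E: "?E = (\<Union>p\<in>I. G p)"
  proof (rule set_eqI)
    fix w
    have "h w \<in> A" "k w \<in> B"
      unfolding h_def k_def using ne by (auto intro: hub_in)
    then show "w \<in> ?E \<longleftrightarrow> w \<in> (\<Union>p\<in>I. G p)"
      by (auto simp: G_def inS I_def)
  qed
  show "?E \<in> events"
    unfolding E by (intro sets.finite_UN G) auto
  have "prob ?E \<le> (\<Sum>p\<in>I. prob (G p))"
    unfolding E by (intro finite_measure_subadditive_finite) (use G in auto)
  also have "\<dots> = (\<Sum>p\<in>I. prob (F p)) * measure \<nu> {u<..}"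
    unfolding G_def F_def sum_distrib_right
    by (intro sum.cong refl prob_weights_and_noise edge S)
  also have "(\<Sum>p\<in>I. prob (F p)) = prob (\<Union>p\<in>I. F p)"
    by (rule finite_measure_finite_Union[symmetric])
      (use F in \<open>auto simp: disjoint_family_on_def F_def inS\<close>)
  also have "\<dots> * measure \<nu> {u<..} \<le> 1 * measure \<nu> {u<..}"
    by (intro mult_right_mono) auto
  finally show "prob ?E \<le> measure \<nu> {u<..}"
    by simp
qed

text \<open>
  If every \<open>A i\<close> contains a vertex of weight at least \<open>s i\<close> and the edges between consecutive
  hubs have noise at most \<open>u\<close>, then the walk through the hubs takes time at most \<open>m * K\<close>. The
  right-hand side is the union bound over the failures of these requirements.
\<close>

lemma prob_passage_time_chain:
  fixes A :: "nat \<Rightarrow> 'd vertex set"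
  assumes fin: "\<And>i. i \<le> m \<Longrightarrow> finite (A i)" and ne: "\<And>i. i \<le> m \<Longrightarrow> A i \<noteq> {}"
    and ends: "A 0 = {x}" "A m = {y}"
    and s: "\<And>i. i \<le> m \<Longrightarrow> 0 < s i" and u: "0 \<le> u" and K: "0 \<le> K"
    and cost: "\<And>i a b. i < m \<Longrightarrow> a \<in> A i \<Longrightarrow> b \<in> A (Suc i) \<Longrightarrow>
      l1_norm (a - b) powr \<alpha> * u / (s i * s (Suc i)) \<le> K"
  shows "prob {w \<in> space M. ennreal (real m * K) < passage_time \<alpha> V \<omega> x y w}
    \<le> (\<Sum>i\<le>m. (1 - measure \<mu> {s i..}) ^ card (A i)) + real m * measure \<nu> {u<..}"
proof -
  define h where "h = (\<lambda>i w. hub (A i) (s i) (\<lambda>a. V a w))"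
  define N where "N = (\<lambda>i. {w \<in> space M. \<forall>a\<in>A i. V a w < s i})"
  define E where "E = (\<lambda>i. {w \<in> space M. h i w \<noteq> h (Suc i) w \<and> u < \<omega> {h i w, h (Suc i) w} w})"
  have N: "N i \<in> events" if "i \<le> m" for i
    unfolding N_def by (rule sets.sets_Collect_finite_All) (use fin[OF that] in auto)
  have E: "E i \<in> events" "prob (E i) \<le> measure \<nu> {u<..}" if "i < m" for i
    using prob_noise_between_hubs[of "A i" "A (Suc i)"] fin ne that
    unfolding E_def h_def by auto
  have "{w \<in> space M. ennreal (real m * K) < passage_time \<alpha> V \<omega> x y w}
      \<subseteq> (\<Union>i\<le>m. N i) \<union> (\<Union>i<m. E i)"
  proof (rule subsetI, rule ccontr)
    fix w assume w: "w \<in> {w \<in> space M. ennreal (real m * K) < passage_time \<alpha> V \<omega> x y w}"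
      and "w \<notin> (\<Union>i\<le>m. N i) \<union> (\<Union>i<m. E i)"
    then have notN: "\<exists>a\<in>A i. s i \<le> V a w" if "i \<le> m" for i
      using that by (auto simp: N_def not_less)
    have notE: "h i w = h (Suc i) w \<or> \<omega> {h i w, h (Suc i) w} w \<le> u" if "i < m" for i
      using that w \<open>w \<notin> _\<close> by (auto simp: E_def not_less)
    have hA: "h i w \<in> A i" and hV: "s i \<le> V (h i w) w" if "i \<le> m" for i
      using hub_in[OF ne[OF that]] notN[OF that] hub_ge[of _ "A i" "s i" "\<lambda>a. V a w"]
      by (auto simp: h_def)
    have edge: "edge_time \<alpha> V \<omega> (h i w) (h (Suc i) w) w \<le> ennreal K" if i: "i < m" for i
    proof (cases "h i w = h (Suc i) w")
      case True
      then show ?thesis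
        by (simp add: edge_time_def l1_norm_def)
    next
      case False
      let ?D = "l1_norm (h i w - h (Suc i) w) powr \<alpha>"
      have pos: "0 < s i" "0 < s (Suc i)"
        using s i by auto
      have V: "s i \<le> V (h i w) w" "s (Suc i) \<le> V (h (Suc i) w) w"
        using hV i by auto
      have "?D * \<omega> {h i w, h (Suc i) w} w / (V (h i w) w * V (h (Suc i) w) w)
          \<le> ?D * u / (V (h i w) w * V (h (Suc i) w) w)"
        using notE[OF i] False pos V by (intro divide_right_mono mult_left_mono) auto
      also have "\<dots> \<le> ?D * u / (s i * s (Suc i))"
        using pos V u by (intro divide_left_mono mult_mono mult_nonneg_nonneg mult_pos_pos) auto
      also have "\<dots> \<le> K"
        using hA i by (intro cost) auto
      finally show ?thesis
        unfolding edge_time_def by (rule ennreal_leI)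
    qed
    have "h 0 w = x" "h m w = y"
      using hA[of 0] hA[of m] ends by auto
    then have "passage_time \<alpha> V \<omega> x y w \<le> (\<Sum>i<m. edge_time \<alpha> V \<omega> (h i w) (h (Suc i) w) w)"
      using passage_time_le_sum_edge_times[of \<alpha> V \<omega> "\<lambda>i. h i w" m w] by simp
    also have "\<dots> \<le> (\<Sum>i<m. ennreal K)"
      by (intro sum_mono edge) auto
    also have "\<dots> = ennreal (real m * K)"
      using K by (simp add: ennreal_mult ennreal_of_nat_eq_real_of_nat)
    finally show False
      using w by auto
  qed
  then have "prob {w \<in> space M. ennreal (real m * K) < passage_time \<alpha> V \<omega> x y w}
      \<le> prob ((\<Union>i\<le>m. N i) \<union> (\<Union>i<m. E i))"
    by (intro finite_measure_mono sets.Un sets.finite_UN) (use N E in auto)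
  also have "\<dots> \<le> prob (\<Union>i\<le>m. N i) + prob (\<Union>i<m. E i)"
    by (intro measure_Un_le sets.finite_UN) (use N E in auto)
  also have "prob (\<Union>i\<le>m. N i) \<le> (\<Sum>i\<le>m. prob (N i))"
    by (intro finite_measure_subadditive_finite) (use N in auto)
  also have "(\<Sum>i\<le>m. prob (N i)) = (\<Sum>i\<le>m. (1 - measure \<mu> {s i..}) ^ card (A i))"
    unfolding N_def by (intro sum.cong refl prob_weights_small fin ne) auto
  also have "prob (\<Union>i<m. E i) \<le> (\<Sum>i<m. prob (E i))"
    by (intro finite_measure_subadditive_finite) (use E in auto)
  also have "(\<Sum>i<m. prob (E i)) \<le> (\<Sum>i<m. measure \<nu> {u<..})"
    by (intro sum_mono E) auto
  finally show ?thesis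
    by simp
qed

end

section \<open>Cubes in the lattice\<close>

definition cube :: "'d::finite vertex \<Rightarrow> real \<Rightarrow> 'd vertex set" where
  "cube c r = {v. \<forall>i. real_of_int \<bar>v $ i - c $ i\<bar> \<le> r}"

lemma cube_eq_image:
  "cube c r = vec_lambda ` (PiE UNIV (\<lambda>i. {c $ i - \<lfloor>r\<rfloor>..c $ i + \<lfloor>r\<rfloor>}))"
proof -
  have *: "v \<in> cube c r \<longleftrightarrow> vec_nth v \<in> PiE UNIV (\<lambda>i. {c $ i - \<lfloor>r\<rfloor>..c $ i + \<lfloor>r\<rfloor>})" for v
    unfolding cube_def le_floor_iff[symmetric] by (auto simp: PiE_iff abs_le_iff algebra_simps)
  show ?thesis
  proof (intro set_eqI iffI)
    fix v assume "v \<in> cube c r"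
    then show "v \<in> vec_lambda ` (PiE UNIV (\<lambda>i. {c $ i - \<lfloor>r\<rfloor>..c $ i + \<lfloor>r\<rfloor>}))"
      using * by (intro image_eqI[of _ _ "vec_nth v"]) auto
  qed (auto simp: *)
qed

lemma finite_cube: "finite (cube c r)"
  unfolding cube_eq_image by (intro finite_imageI finite_PiE) auto

lemma card_cube_ge:
  fixes c :: "'d::finite vertex"
  assumes "0 \<le> r"
  shows "r ^ CARD('d) \<le> real (card (cube c r))"
proof -
  have "card (cube c r) = card (PiE UNIV (\<lambda>i. {c $ i - \<lfloor>r\<rfloor>..c $ i + \<lfloor>r\<rfloor>}))"
    unfolding cube_eq_image by (intro card_image inj_onI) (metis vec_lambda_inverse UNIV_I)
  also have "\<dots> = nat (2 * \<lfloor>r\<rfloor> + 1) ^ CARD('d)"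
    by (simp add: card_PiE algebra_simps)
  finally have "real (card (cube c r)) = real (nat (2 * \<lfloor>r\<rfloor> + 1)) ^ CARD('d)"
    by simp
  moreover have "r \<le> real (nat (2 * \<lfloor>r\<rfloor> + 1))"
  proof -
    have "0 \<le> \<lfloor>r\<rfloor>"
      using assms by simp
    then have "r \<le> real_of_int (2 * \<lfloor>r\<rfloor> + 1)" "0 \<le> 2 * \<lfloor>r\<rfloor> + 1"
      by linarith+
    then show ?thesis
      by simp
  qed
  ultimately show ?thesis
    using assms by (simp add: power_mono)
qed

lemma center_in_cube: "0 \<le> r \<Longrightarrow> c \<in> cube c r"
  by (simp add: cube_def)

lemma l1_norm_le:
  fixes v :: "'d::finite vertex"
  assumes "\<And>i. real_of_int \<bar>v $ i\<bar> \<le> r"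
  shows "l1_norm v \<le> real CARD('d) * r"
  unfolding l1_norm_def using assms sum_bounded_above[of UNIV "\<lambda>i. real_of_int \<bar>v $ i\<bar>" r] by simp

section \<open>Asymptotics of the failure probabilities\<close>

text \<open>
  Where \<open>measure \<mu> {t..}\<close> vanishes, the convention \<open>ln 0 = 0\<close> makes the quotient \<open>0\<close>, which is
  far from the negative limit. So the tail is eventually positive, and the limit can be
  exponentiated.
\<close>

lemma tail_lower_bound:
  assumes lim: "((\<lambda>t. ln (measure \<mu> {t..}) / ln t) \<longlongrightarrow> - \<gamma>) at_top"
    and pos: "0 < \<gamma>" "0 < \<eta>"
  shows "\<forall>\<^sub>F t in at_top. t powr - (\<gamma> + \<eta>) \<le> measure \<mu> {t..}"
proof -
  have "\<forall>\<^sub>F t in at_top. - (\<gamma> + \<eta>) < ln (measure \<mu> {t..}) / ln t"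
    using pos by (intro order_tendstoD(1)[OF lim]) simp
  moreover have "\<forall>\<^sub>F t in at_top. ln (measure \<mu> {t..}) / ln t < 0"
    using pos by (intro order_tendstoD(2)[OF lim]) simp
  moreover have "\<forall>\<^sub>F t in at_top. (1::real) < t"
    by (rule eventually_gt_at_top)
  ultimately show ?thesis
  proof eventually_elim
    case (elim t)
    have "measure \<mu> {t..} \<noteq> 0"
      using elim(2) by auto
    then have p: "0 < measure \<mu> {t..}"
      by (simp add: zero_less_measure_iff)
    have "- (\<gamma> + \<eta>) * ln t < ln (measure \<mu> {t..})"
      using elim(1,3) by (simp add: pos_less_divide_eq)
    then have "exp (- (\<gamma> + \<eta>) * ln t) \<le> exp (ln (measure \<mu> {t..}))"
      by simp
    then show ?case
      using p elim(3) by (simp add: powr_def)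
  qed
qed

text \<open>
  The expected number of vertices in the cube whose weight reaches the threshold is at least
  a positive power of \<open>n\<close>, because the threshold lies below the typical maximum by the factor
  \<open>n powr \<kappa>\<close>. By independence, the probability that there is none is at most the exponential of
  minus this number.
\<close>

lemma no_hub_in_cube_tendsto_0:
  fixes c :: "nat \<Rightarrow> 'd::finite vertex"
  assumes mu: "prob_space \<mu>" "sets \<mu> = sets borel"
    and lim: "((\<lambda>t. ln (measure \<mu> {t..}) / ln t) \<longlongrightarrow> - \<gamma>) at_top"
    and pos: "0 < \<gamma>" "0 < \<kappa>" and kappa: "\<kappa> < \<rho> * (real CARD('d) / \<gamma>)"
  shows "(\<lambda>n. (1 - measure \<mu> {real n powr (\<rho> * (real CARD('d) / \<gamma>) - \<kappa>)..})
            ^ card (cube (c n) (real n powr \<rho>))) \<longlonglongrightarrow> 0"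
proof -
  interpret \<mu>: prob_space \<mu> by (rule mu)
  define \<beta> where "\<beta> = real CARD('d) / \<gamma>"
  define \<sigma> where "\<sigma> = \<rho> * \<beta> - \<kappa>"
  \<comment> \<open>Replacing \<open>\<gamma>\<close> by \<open>\<gamma> + \<eta>\<close> in the tail costs the exponent \<open>\<sigma> * \<eta>\<close>, which is half of
    the gain \<open>\<kappa> * \<gamma>\<close> that comes from lowering the threshold.\<close>
  define \<eta> where "\<eta> = \<kappa> * \<gamma> / (2 * \<sigma>)"
  have \<sigma>: "0 < \<sigma>"
    using kappa by (simp add: \<sigma>_def \<beta>_def)
  have \<eta>: "0 < \<eta>"
    using pos \<sigma> by (simp add: \<eta>_def)
  have "\<rho> * real CARD('d) - \<sigma> * (\<gamma> + \<eta>) = \<rho> * real CARD('d) - \<sigma> * \<gamma> - \<kappa> * \<gamma> / 2"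
    using \<sigma> by (simp add: \<eta>_def field_simps)
  also have "\<sigma> * \<gamma> = \<rho> * real CARD('d) - \<kappa> * \<gamma>"
    using pos by (simp add: \<sigma>_def \<beta>_def field_simps)
  finally have exponent: "- \<sigma> * (\<gamma> + \<eta>) + \<rho> * real CARD('d) = \<kappa> * \<gamma> / 2"
    by simp
  let ?p = "\<lambda>n. measure \<mu> {real n powr \<sigma>..}"
  let ?N = "\<lambda>n. card (cube (c n) (real n powr \<rho>))"
  have "filterlim (\<lambda>n. real n powr \<sigma>) at_top sequentially"
    using \<sigma> by real_asymp
  from eventually_compose_filterlim[OF tail_lower_bound[OF lim pos(1) \<eta>] this]
  have tail: "\<forall>\<^sub>F n in sequentially. (real n powr \<sigma>) powr - (\<gamma> + \<eta>) \<le> ?p n" .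
  have bound: "\<forall>\<^sub>F n in sequentially. (1 - ?p n) ^ ?N n \<le> exp (- (real n powr (\<kappa> * \<gamma> / 2)))"
    using tail eventually_gt_at_top[of 0]
  proof eventually_elim
    case (elim n)
    have "real n powr (\<kappa> * \<gamma> / 2) = real n powr (- \<sigma> * (\<gamma> + \<eta>)) * real n powr (\<rho> * real CARD('d))"
      by (simp only: exponent[symmetric] powr_add)
    also have "real n powr (\<rho> * real CARD('d)) = (real n powr \<rho>) ^ CARD('d)"
      using elim(2) by (simp add: powr_powr flip: powr_realpow)
    also have "real n powr (- \<sigma> * (\<gamma> + \<eta>)) * \<dots> \<le> ?p n * real (?N n)"
    proof (intro mult_mono card_cube_ge)
      show "real n powr (- \<sigma> * (\<gamma> + \<eta>)) \<le> ?p n"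
        using elim(1) by (simp only: powr_powr mult_minus_left mult_minus_right)
    qed auto
    finally have *: "real n powr (\<kappa> * \<gamma> / 2) \<le> ?p n * real (?N n)" .
    have "1 - ?p n \<le> exp (- ?p n)"
      using exp_ge_add_one_self[of "- ?p n"] by simp
    then have "(1 - ?p n) ^ ?N n \<le> exp (- ?p n) ^ ?N n"
      by (intro power_mono) auto
    also have "\<dots> = exp (- (?p n * real (?N n)))"
      by (simp add: exp_of_nat_mult[symmetric] mult.commute)
    also have "\<dots> \<le> exp (- (real n powr (\<kappa> * \<gamma> / 2)))"
      using * by simp
    finally show ?case .
  qed
  have "(\<lambda>n. (1 - ?p n) ^ ?N n) \<longlonglongrightarrow> 0"
  proof (rule tendsto_sandwich[OF _ bound tendsto_const])
    show "\<forall>\<^sub>F n in sequentially. 0 \<le> (1 - ?p n) ^ ?N n"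
      by (intro always_eventually allI zero_le_power) simp
    have "0 < \<kappa> * \<gamma> / 2"
      using pos by simp
    then show "(\<lambda>n. exp (- (real n powr (\<kappa> * \<gamma> / 2)))) \<longlonglongrightarrow> 0"
      by real_asymp
  qed
  then show ?thesis
    by (simp add: \<sigma>_def \<beta>_def)
qed

lemma small_weight_tendsto_0:
  assumes mu: "prob_space \<mu>" "sets \<mu> = sets borel" "AE t in \<mu>. t > 0"
    and pos: "0 < (\<kappa>::real)"
  shows "(\<lambda>n. 1 - measure \<mu> {real n powr - \<kappa>..}) \<longlonglongrightarrow> 0"
proof -
  interpret \<mu>: real_distribution \<mu>
    using mu by (intro real_distribution.intro real_distribution_axioms.intro) auto
  have "AE t in \<mu>. t \<notin> {..0}"
    using mu(3) by eventually_elim simp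
  then have "cdf \<mu> 0 = 0"
    unfolding cdf_def by (subst \<mu>.prob_eq_0) auto
  then have "(cdf \<mu> \<longlongrightarrow> 0) (at_right 0)"
    using \<mu>.cdf_is_right_cont[of 0] by (simp add: continuous_within)
  moreover have "filterlim (\<lambda>n. real n powr - \<kappa>) (at_right 0) sequentially"
    using pos by real_asymp
  ultimately have lim: "(\<lambda>n. cdf \<mu> (real n powr - \<kappa>)) \<longlonglongrightarrow> 0"
    by (rule filterlim_compose)
  have "1 - measure \<mu> {s..} = measure \<mu> {..<s}" for s
    using \<mu>.prob_compl[of "{s..}"] by (simp add: Compl_eq_Diff_UNIV[symmetric])
  also have "measure \<mu> {..<s} \<le> cdf \<mu> s" for s
    unfolding cdf_def by (intro \<mu>.finite_measure_mono) auto
  finally have "1 - measure \<mu> {s..} \<le> cdf \<mu> s" for s .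
  then show ?thesis
    by (intro tendsto_sandwich[OF _ _ tendsto_const lim]) auto
qed

lemma large_noise_tendsto_0:
  assumes nu: "prob_space \<nu>" "sets \<nu> = sets borel"
    and pos: "0 < (\<kappa>::real)"
  shows "(\<lambda>n. measure \<nu> {real n powr \<kappa><..}) \<longlonglongrightarrow> 0"
proof -
  interpret \<nu>: real_distribution \<nu>
    using nu by (intro real_distribution.intro real_distribution_axioms.intro) auto
  have "filterlim (\<lambda>n. real n powr \<kappa>) at_top sequentially"
    using pos by real_asymp
  from filterlim_compose[OF \<nu>.cdf_lim_at_top_prob this]
  have "(\<lambda>n. 1 - cdf \<nu> (real n powr \<kappa>)) \<longlonglongrightarrow> 1 - 1"
    by (intro tendsto_diff tendsto_const)
  moreover have "1 - cdf \<nu> t = measure \<nu> {t<..}" for t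
    using \<nu>.prob_compl[of "{..t}"] by (simp add: cdf_def Compl_eq_Diff_UNIV[symmetric])
  ultimately show ?thesis
    by simp
qed

section \<open>Climbing and descending through the hubs\<close>

theorem theorem2p9:
  fixes M :: "'w measure"
    and \<mu> \<nu> :: "real measure"
    and V :: "'d::finite vertex \<Rightarrow> 'w \<Rightarrow> real"
    and \<omega> :: "'d vertex set \<Rightarrow> 'w \<Rightarrow> real"
    and \<alpha> \<gamma> \<theta> \<zeta> \<Delta> :: real
    and x :: "real ^ 'd"
    and T :: "nat \<Rightarrow> 'w \<Rightarrow> ennreal"
  assumes model: "ilrfpp M \<mu> \<nu> \<alpha> V \<omega>"
    and standing: "standing_assumptions \<mu> \<nu> \<gamma> \<theta> \<zeta>"
    and alpha_lower: "2 * real CARD('d) / \<gamma> < \<alpha>"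
    and alpha_upper: "\<alpha> < 2 * real CARD('d) / \<gamma> + 1"
    and Delta: "\<Delta> = \<alpha> - 2 * real CARD('d) / \<gamma>"
    and x: "infnorm x \<le> 1" "x \<noteq> 0"
    and T: "\<And>n. T n = passage_time \<alpha> V \<omega> 0 (ceiling_vec (real n *\<^sub>R x))"
  shows "(\<forall>\<epsilon>>0. \<exists>C::real.
            (\<lambda>n. \<P>(w in M. T n w > ennreal (C * real n powr (\<Delta> + \<epsilon>)))) \<longlonglongrightarrow> 0) \<and>
         (\<forall>\<epsilon>>0. bigo_in_prob M T (\<lambda>n. real n powr (\<alpha> - 2 * real CARD('d) / \<gamma> + \<epsilon>)))"
proof -
  interpret ilrfpp M \<mu> \<nu> \<alpha> V \<omega> by (rule model)
  have \<gamma>: "0 < \<gamma>" and V_pos: "AE t in \<mu>. t > 0"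
    and tail: "((\<lambda>t. ln (measure \<mu> {t..}) / ln t) \<longlongrightarrow> - \<gamma>) at_top"
    using standing by (auto simp: standing_assumptions_def)
  have mu: "prob_space \<mu>" "sets \<mu> = sets borel"
    unfolding law_V[of 0, symmetric] by (auto intro: prob_space_distr)
  define d where "d = real CARD('d)"
  define \<beta> where "\<beta> = d / \<gamma>"
  define y where "y = (\<lambda>n. ceiling_vec (real n *\<^sub>R x))"
  have T_y: "T n = passage_time \<alpha> V \<omega> 0 (y n)" for n
    by (simp add: T y_def)
  have d: "0 < d" and \<beta>: "0 < \<beta>"
    using \<gamma> by (auto simp: d_def \<beta>_def)
  have \<Delta>: "\<Delta> = \<alpha> - 2 * \<beta>" "0 < \<Delta>"
    using alpha_lower Delta by (auto simp: \<beta>_def d_def)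
  have y_bound: "real_of_int \<bar>y n $ k\<bar> \<le> real n" for n k
  proof -
    have "\<bar>x $ k\<bar> \<le> 1"
      using x(1) component_le_infnorm_cart[of x k] by linarith
    then have "\<bar>real n * x $ k\<bar> \<le> real n"
      by (simp add: abs_mult mult_left_le)
    then have "\<bar>\<lceil>real n * x $ k\<rceil>\<bar> \<le> int n"
      unfolding abs_le_iff by (simp add: ceiling_le_iff) linarith
    then show ?thesis
      unfolding y_def ceiling_vec_def by simp
  qed
  have nu: "prob_space \<nu>" "sets \<nu> = sets borel"
  proof -
    obtain e :: "'d vertex set" where e: "e \<in> edges"
      unfolding edges_def using zero_neq_one[where 'a = "int ^ 'd"] by blast
    show "prob_space \<nu>" "sets \<nu> = sets borel"
      unfolding law_omega[OF e, symmetric] using e by (auto intro: prob_space_distr)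
  qed
  have main: "\<exists>C. (\<lambda>n. \<P>(w in M. T n w > ennreal (C * real n powr (\<Delta> + \<epsilon>)))) \<longlonglongrightarrow> 0"
    if \<epsilon>: "0 < \<epsilon>" for \<epsilon>
  proof -
    \<comment> \<open>The loss \<open>\<beta> / J\<close> from passing between consecutive scales is at most \<open>\<epsilon> / 2\<close>. The factor
      \<open>n powr \<kappa>\<close> is lost three times on each edge, at both hubs and in the noise, which accounts for
      the other \<open>\<epsilon> / 2\<close>. The bound by \<open>\<beta> / (2 * J)\<close> keeps the thresholds at positive scales large.\<close>
    define J where "J = Suc (nat \<lceil>2 * \<beta> / \<epsilon>\<rceil>)"
    define \<kappa> where "\<kappa> = min (\<epsilon> / 6) (\<beta> / (2 * real J))"
    have J: "0 < J" "\<beta> / real J \<le> \<epsilon> / 2"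
    proof -
      have "2 * \<beta> / \<epsilon> \<le> real J"
        unfolding J_def by linarith
      then show "\<beta> / real J \<le> \<epsilon> / 2"
        using \<epsilon> by (simp add: J_def field_simps)
    qed (simp add: J_def)
    have \<kappa>: "0 < \<kappa>" "3 * \<kappa> \<le> \<epsilon> / 2" "\<kappa> < \<beta> / real J"
    proof -
      have "\<kappa> \<le> \<epsilon> / 6" "\<kappa> \<le> \<beta> / (2 * real J)"
        unfolding \<kappa>_def by (rule min.cobounded1, rule min.cobounded2)
      moreover have "\<beta> / (2 * real J) < \<beta> / real J"
        using J \<beta> by (simp add: field_simps)
      ultimately show "3 * \<kappa> \<le> \<epsilon> / 2" "\<kappa> < \<beta> / real J"
        by linarith+
      show "0 < \<kappa>"
        using \<epsilon> \<beta> J by (simp add: \<kappa>_def)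
    qed
    \<comment> \<open>The chain has the positions \<open>0, \<dots>, m\<close>: up the scales \<open>0, \<dots>, J\<close> around the origin, then
      down the same scales around the target. At scale \<open>0\<close> the cube is replaced by its centre,
      as the chain has to start and end at the given vertices.\<close>
    define r where "r = (\<lambda>i. if i \<le> J then i else 2 * J + 1 - i)"
    define \<rho> where "\<rho> = (\<lambda>i. real (r i) / real J)"
    define c where "c = (\<lambda>n i. if i \<le> J then 0 else y n)"
    define A where "A = (\<lambda>n i. if r i = 0 then {c n i} else cube (c n i) (real n powr \<rho> i))"
    define s where "s = (\<lambda>n i. real n powr (\<rho> i * \<beta> - \<kappa>))"
    define u where "u = (\<lambda>n. real n powr \<kappa>)"
    define m where "m = 2 * J + 1"
    define K where "K = (\<lambda>n. (3 * d) powr \<alpha> * real n powr (\<Delta> + \<epsilon>))"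
    have \<rho>: "0 \<le> \<rho> i" "\<rho> i \<le> 1" for i
      using J by (auto simp: \<rho>_def r_def)
    have \<rho>_step: "\<bar>\<rho> i - \<rho> (Suc i)\<bar> \<le> 1 / real J" for i
    proof -
      have "\<bar>real (r i) - real (r (Suc i))\<bar> \<le> 1"
        by (auto simp: r_def)
      then show ?thesis
        using J by (simp add: \<rho>_def abs_divide flip: diff_divide_distrib) (simp add: divide_right_mono)
    qed
    have cost: "l1_norm (a - b) powr \<alpha> * u n / (s n i * s n (Suc i)) \<le> K n"
      if n: "1 \<le> n" and i: "i < m" and a: "a \<in> A n i" and b: "b \<in> A n (Suc i)" for n i a b
    proof -
      let ?N = "real n"
      define \<tau> where "\<tau> = max (\<rho> i) (\<rho> (Suc i))"
      have \<tau>: "\<rho> i \<le> \<tau>" "\<rho> (Suc i) \<le> \<tau>" "0 \<le> \<tau>" "\<tau> \<le> 1"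
        using \<rho>[of i] \<rho>[of "Suc i"] by (auto simp: \<tau>_def)
      have "real_of_int \<bar>a $ k - b $ k\<bar> \<le> 3 * ?N powr \<tau>" for k
      proof -
        have near: "real_of_int \<bar>v $ k - c n j $ k\<bar> \<le> ?N powr \<tau>" if "v \<in> A n j" "\<rho> j \<le> \<tau>" for v j
        proof -
          have "real_of_int \<bar>v $ k - c n j $ k\<bar> \<le> ?N powr \<rho> j"
            using that by (auto simp: A_def cube_def split: if_splits)
          also have "\<dots> \<le> ?N powr \<tau>"
            using that n by (intro powr_mono) auto
          finally show ?thesis .
        qed
        have "real_of_int \<bar>c n i $ k - c n (Suc i) $ k\<bar> \<le> ?N powr \<tau>"
        proof (cases "i = J")
          \<comment> \<open>The jump from the origin's side to the target's side.\<close>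
          case True
          then have "\<tau> = 1"
            using \<tau> J by (simp add: \<tau>_def \<rho>_def r_def)
          then show ?thesis
            using y_bound[of n k] True n by (simp add: c_def)
        qed (auto simp: c_def)
        then show ?thesis
          using near[OF a \<tau>(1)] near[OF b \<tau>(2)] by linarith
      qed
      then have "l1_norm (a - b) \<le> d * (3 * ?N powr \<tau>)"
        unfolding d_def by (intro l1_norm_le) simp
      then have "l1_norm (a - b) powr \<alpha> \<le> (3 * d * ?N powr \<tau>) powr \<alpha>"
        using alpha_pos by (intro powr_mono2) (auto simp: l1_norm_def sum_nonneg mult_ac)
      also have "\<dots> = (3 * d) powr \<alpha> * ?N powr (\<tau> * \<alpha>)"
        using d by (simp add: powr_mult powr_powr)
      finally have "l1_norm (a - b) powr \<alpha> * u n / (s n i * s n (Suc i))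
          \<le> (3 * d) powr \<alpha> * ?N powr (\<tau> * \<alpha>) * u n / (s n i * s n (Suc i))"
        by (intro divide_right_mono mult_right_mono) (auto simp: u_def s_def)
      also have "\<dots> = (3 * d) powr \<alpha> * ?N powr (\<tau> * \<alpha> + \<kappa> - ((\<rho> i * \<beta> - \<kappa>) + (\<rho> (Suc i) * \<beta> - \<kappa>)))"
        unfolding u_def s_def by (simp only: powr_add powr_diff mult.assoc times_divide_eq_right)
      also have "\<dots> \<le> K n"
      proof -
        \<comment> \<open>Consecutive scales differ by at most \<open>1 / J\<close>, so the two hubs are nearly as heavy
          as two hubs of the larger of the two scales.\<close>
        have "2 * \<tau> - 1 / real J \<le> \<rho> i + \<rho> (Suc i)"
          using \<rho>_step[of i] by (auto simp: \<tau>_def max_def)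
        then have "(2 * \<tau> - 1 / real J) * \<beta> \<le> (\<rho> i + \<rho> (Suc i)) * \<beta>"
          using \<beta> by (intro mult_right_mono) auto
        then have "2 * (\<tau> * \<beta>) - \<beta> / real J \<le> \<rho> i * \<beta> + \<rho> (Suc i) * \<beta>"
          by (simp add: left_diff_distrib distrib_right)
        moreover have "\<tau> * \<Delta> \<le> \<Delta>"
          using \<tau> \<Delta> by (simp add: mult_left_le_one_le)
        moreover have "\<tau> * \<alpha> = \<tau> * \<Delta> + 2 * (\<tau> * \<beta>)"
          unfolding \<Delta>(1) by (simp add: algebra_simps)
        ultimately have "\<tau> * \<alpha> + \<kappa> - ((\<rho> i * \<beta> - \<kappa>) + (\<rho> (Suc i) * \<beta> - \<kappa>)) \<le> \<Delta> + \<epsilon>"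
          using J(2) \<kappa>(2) by linarith
        then show ?thesis
          unfolding K_def using n d by (intro mult_left_mono powr_mono) auto
      qed
      finally show ?thesis .
    qed
    have r_ends: "r 0 = 0" "r m = 0"
      by (simp_all add: r_def m_def)
    have c_ends: "c n 0 = 0" "c n m = y n" for n
      using J by (simp_all add: c_def m_def)
    have bound: "\<P>(w in M. T n w > ennreal (real m * K n))
        \<le> (\<Sum>i\<le>m. (1 - measure \<mu> {s n i..}) ^ card (A n i)) + real m * measure \<nu> {u n<..}"
      if n: "1 \<le> n" for n
      unfolding T_y
    proof (rule prob_passage_time_chain)
      show "finite (A n i)" "A n i \<noteq> {}" for i
        using center_in_cube[of "real n powr \<rho> i" "c n i"] by (auto simp: A_def finite_cube)
      show "A n 0 = {0}" "A n m = {y n}"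
        by (simp_all add: A_def r_ends c_ends)
      show "0 < s n i" for i
        using n by (simp add: s_def)
      show "0 \<le> u n" "0 \<le> K n"
        by (simp_all add: u_def K_def)
      show "l1_norm (a - b) powr \<alpha> * u n / (s n i * s n (Suc i)) \<le> K n"
        if "i < m" "a \<in> A n i" "b \<in> A n (Suc i)" for i a b
        using that by (rule cost[OF n])
    qed
    have no_hub: "(\<lambda>n. (1 - measure \<mu> {s n i..}) ^ card (A n i)) \<longlonglongrightarrow> 0" for i
    proof (cases "r i = 0")
      case True
      then show ?thesis
        using small_weight_tendsto_0[OF mu V_pos \<kappa>(1)] by (simp add: A_def s_def \<rho>_def)
    next
      case False
      then have "1 / real J \<le> \<rho> i"
        unfolding \<rho>_def by (intro divide_right_mono) auto
      then have "1 / real J * \<beta> \<le> \<rho> i * \<beta>"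
        using \<beta> by (intro mult_right_mono) auto
      then have "\<kappa> < \<rho> i * \<beta>"
        using \<kappa>(3) by simp
      from no_hub_in_cube_tendsto_0[OF mu tail \<gamma> \<kappa>(1), of "\<rho> i" "\<lambda>n. c n i"] this False
      show ?thesis
        by (simp add: A_def s_def \<beta>_def d_def)
    qed
    have lim: "(\<lambda>n. (\<Sum>i\<le>m. (1 - measure \<mu> {s n i..}) ^ card (A n i)) + real m * measure \<nu> {u n<..})
        \<longlonglongrightarrow> (\<Sum>i\<le>m. 0) + real m * 0"
      by (intro tendsto_add tendsto_sum tendsto_mult_left no_hub)
        (simp add: u_def large_noise_tendsto_0[OF nu \<kappa>(1)])
    have "(\<lambda>n. \<P>(w in M. T n w > ennreal (real m * K n))) \<longlonglongrightarrow> 0"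
    proof (rule tendsto_sandwich[OF _ eventually_sequentiallyI tendsto_const])
      show "(\<lambda>n. (\<Sum>i\<le>m. (1 - measure \<mu> {s n i..}) ^ card (A n i)) + real m * measure \<nu> {u n<..})
          \<longlonglongrightarrow> 0"
        using lim by simp
    qed (rule always_eventually, simp, erule bound)
    then show ?thesis
      by (intro exI[of _ "real m * (3 * d) powr \<alpha>"]) (simp add: K_def mult.assoc)
  qed
  show ?thesis
  proof (intro conjI allI impI)
    fix \<epsilon> :: real assume \<epsilon>: "0 < \<epsilon>"
    show "\<exists>C. (\<lambda>n. \<P>(w in M. T n w > ennreal (C * real n powr (\<Delta> + \<epsilon>)))) \<longlonglongrightarrow> 0"
      by (rule main[OF \<epsilon>])
    show "bigo_in_prob M T (\<lambda>n. real n powr (\<alpha> - 2 * real CARD('d) / \<gamma> + \<epsilon>))"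
      unfolding bigo_in_prob_def Delta[symmetric]
    proof (intro allI impI)
      fix \<eta> :: real assume "0 < \<eta>"
      obtain C where "(\<lambda>n. \<P>(w in M. T n w > ennreal (C * real n powr (\<Delta> + \<epsilon>)))) \<longlonglongrightarrow> 0"
        using main[OF \<epsilon>] by blast
      from order_tendstoD(2)[OF this \<open>0 < \<eta>\<close>]
      show "\<exists>C. \<forall>\<^sub>F n in sequentially. \<P>(w in M. T n w > ennreal (C * real n powr (\<Delta> + \<epsilon>))) \<le> \<eta>"
        by (intro exI[of _ C]) (auto elim: eventually_mono)
    qed
  qed
qed

end
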